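(* In the power-beacon assisted multi-source network described in the context, with all parameters other than the beacon's transmit power $P_B$ fixed, the energy outage probability in the limit $P_B\to\infty$ is $$\lim_{P_B\to\infty}P_{EO}=\begin{cases}\displaystyle\sum_{n:\ \vec s_n\in\Theta_1}\pi_n, & K=1,\\[2mm] 0,& K\ge 2,\end{cases}$$ where $\pi_n$ is the $n$-th component of $$\boldsymbol\pi=\left(\mathbf A^{T}-\mathbf E+\mathbf Q\right)^{-1}\mathbf b ,$$ with $\mathbf A$ here the (entrywise) limit as $P_B\to\infty$ of the one-step state transition matrix, $\mathbf E$ the $N\times N$ identity matrix, $\mathbf Q$ the $N\times N$ all-ones matrix and $\mathbf b=(1,1,\dots,1)^T\in\mathbb R^N$.
   Context: Network. There are a power beacon $B$ with $N_B\ge 2$ antennas and transmit power $P_B>0$, $K\ge 1$ single-antenna half-duplex sources $S_1,\dots,S_K$, and a single-antenna destination $D$. Time is divided into slots of length $T_0>0$. In each slot the channel coefficients $h_{B_bS_k}$, $h_{B_bD}$ (from antenna $b$ of $B$), $h_{S_kD}$, $h_{S_iS_k}$ are mutually independent circularly symmetric complex Gaussian variables, with $\mathbb E|h_{B_bS_k}|^2=\bar\gamma_{BS_k}$ (for all $b$), $\mathbb E|h_{B_bD}|^2=\bar\gamma_{BD}$, $\mathbb E|h_{S_kD}|^2=\bar\gamma_{S_kD}$, $\mathbb E|h_{S_iS_k}|^2=\bar\gamma_{S_iS_k}$, all positive constants; they are independent from slot to slot. Write $\mathbf h_{BS_k}=[h_{B_1S_k},\dots,h_{B_{N_B}S_k}]^T$,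 $\mathbf h_{BD}=[h_{B_1D},\dots,h_{B_{N_B}D}]^T$. Energy levels. Each source has an energy storage of capacity $\varepsilon_T>0$, discretized into levels $0,1,\dots,L$ ($L\ge1$), level $l$ meaning stored energy $\varepsilon_l=l\,\varepsilon_\Delta$, $\varepsilon_\Delta=\varepsilon_T/L$. The energy states are the $N=(1+L)^K$ vectors $\vec s_n=[l_1^n,\dots,l_K^n]\in\{0,\dots,L\}^K$. A transmission uses $l_S$ energy levels, $1\le l_S\le L$ fixed, with transmit power $P_S=l_S\varepsilon_\Delta/T_0$. Let $\vartheta_n^{TH}=\{k: l_k^n\ge l_S\}$ be the set of (indices of) sources with sufficient energy in state $\vec s_n$, and $\Theta_1=\{\vec s_n:\vartheta_n^{TH}=\emptyset\}$ (non-information-transmission states), $\Theta_2=\{\vec s_n:\vartheta_n^{TH}\neq\emptyset\}$ (information-transmission states). $\eta>0$ is the energy conversion efficiency. Dynamics in one slot, starting from $\vec s_n$. (i) If $\vec s_n\in\Theta_1$, no source transmits and every source $k$ harvests $\varepsilon_k^n=\eta T_0P_B|\mathbf h_{BS_k}^T\mathbf w_1|^2$, where $\mathbf w_1$ has all entries $1/\sqrt{N_B}$; its new level is $\min\{L,\ l_k^n+\lfloor \varepsilon_k^n/\varepsilon_\Delta\rfloor\}$. (ii) If $\vec s_n\in\Theta_2$, the source with index $i^*=\arg\max_{k\in\vartheta_n^{TH}}|h_{S_kD}|^2$ transmits and its level decreases by $l_S$ (it does not harvest). Every other source $k\ne i^*$ harvests $\varepsilon_k^{n,i^*}=\eta T_0\left(P_S|h_{S_{i^*}S_k}|^2+P_B|\mathbf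 h_{BS_k}^T\mathbf w_2|^2\right)$, where $\mathbf w_2$ is a unit-norm vector, a function of $\mathbf h_{BD}$ only, with $\mathbf h_{BD}^T\mathbf w_2=0$; its new level is $\min\{L,\ l_k^n+\lfloor\varepsilon_k^{n,i^*}/\varepsilon_\Delta\rfloor\}$. The energy state thus evolves as a time-homogeneous Markov chain; its state transition matrix has as $(n,n')$ entry the one-step probability of moving from $\vec s_n$ to $\vec s_{n'}$. Energy outage probability. A source is in energy outage when it does not have enough energy to transmit (level below $l_S$); the network is in energy outage when all its sources are simultaneously in energy outage. For given $P_B$, the energy outage probability $P_{EO}$ is the probability, in the stationary regime (unique stationary distribution) of the Markov chain of energy states, that the network is in energy outage. *)

theory Defs
  imports "HOL-Probability.Probability"
begin

text \<open>
  The antennas of the beacon are indexed by the type \<open>'b\<close> and the sources by the type \<open>'k\<close>, so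
  that \<open>N\<^sub>B = CARD('b)\<close> and \<open>K = CARD('k)\<close>.  A link is a transmitter--receiver pair; \<open>SS i k\<close> is
  the link from source \<open>i\<close> to source \<open>k\<close> and is meaningful for \<open>i \<noteq> k\<close> only.
\<close>

datatype ('b, 'k) link = BS 'b 'k | BD 'b | SD 'k | SS 'k 'k

definition links :: "('b, 'k) link set" where
  "links = {c. \<forall>k. c \<noteq> SS k k}"

text \<open>
  All parameters except the transmit power of the beacon.  The field \<open>null_beam\<close> is the map
  \<open>h\<^bsub>BD\<^esub> \<mapsto> w\<^sub>2\<close>.
\<close>

record ('b::finite, 'k) network =
  slot_length :: real
  efficiency :: real
  capacity :: real
  max_level :: nat
  tx_levels :: nat
  gain_BS :: "'k \<Rightarrow> real"
  gain_BD :: real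
  gain_SD :: "'k \<Rightarrow> real"
  gain_SS :: "'k \<Rightarrow> 'k \<Rightarrow> real"
  null_beam :: "complex ^ 'b \<Rightarrow> complex ^ 'b"

primrec mean_gain :: "('b::finite, 'k) network \<Rightarrow> ('b, 'k) link \<Rightarrow> real" where
  "mean_gain net (BS b k) = gain_BS net k"
| "mean_gain net (BD b) = gain_BD net"
| "mean_gain net (SD k) = gain_SD net k"
| "mean_gain net (SS i k) = gain_SS net i k"

text \<open>The transpose product \<open>v\<^sup>T w\<close>: there is no complex conjugation.\<close>

definition tdot :: "complex ^ 'b::finite \<Rightarrow> complex ^ 'b \<Rightarrow> complex" where
  "tdot v w = (\<Sum>b\<in>UNIV. v $ b * w $ b)"

definition uniform_beam :: "complex ^ 'b::finite" where
  "uniform_beam = (\<chi> b. complex_of_real (1 / sqrt (real CARD('b))))"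

text \<open>
  Circularly symmetric complex Gaussian: real and imaginary part are independent centred normal
  variables of variance \<open>v / 2\<close> each, whence \<open>E|X|\<^sup>2 = v\<close>.
\<close>

definition circ_complex_gaussian :: "'a measure \<Rightarrow> ('a \<Rightarrow> complex) \<Rightarrow> real \<Rightarrow> bool" where
  "circ_complex_gaussian M X v \<longleftrightarrow>
     prob_space.indep_var M borel (\<lambda>\<omega>. Re (X \<omega>)) borel (\<lambda>\<omega>. Im (X \<omega>)) \<and>
     distributed M lborel (\<lambda>\<omega>. Re (X \<omega>)) (normal_density 0 (sqrt (v / 2))) \<and>
     distributed M lborel (\<lambda>\<omega>. Im (X \<omega>)) (normal_density 0 (sqrt (v / 2)))"

text \<open>\<open>h t c \<omega>\<close> is the coefficient of link \<open>c\<close> in slot \<open>t\<close>.\<close>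

locale beacon_network = prob_space M
  for net :: "('b::finite, 'k::finite) network"
    and M :: "'a measure"
    and h :: "nat \<Rightarrow> ('b, 'k) link \<Rightarrow> 'a \<Rightarrow> complex" +
  assumes antennas: "CARD('b) \<ge> 2"
    and slot_length_pos: "slot_length net > 0"
    and efficiency_pos: "efficiency net > 0"
    and capacity_pos: "capacity net > 0"
    and tx_levels_pos: "1 \<le> tx_levels net"
    and tx_levels_le: "tx_levels net \<le> max_level net"
    and mean_gain_pos: "\<And>c. c \<in> links \<Longrightarrow> mean_gain net c > 0"
    and null_beam_measurable: "null_beam net \<in> borel_measurable borel"
    and null_beam_norm: "\<And>v. norm (null_beam net v) = 1"
    and null_beam_orthogonal: "\<And>v. tdot v (null_beam net v) = 0"
    and channels_gaussian:
      "\<And>t c. c \<in> links \<Longrightarrow> circ_complex_gaussian M (h t c) (mean_gain net c)"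
    and channels_indep: "indep_vars (\<lambda>_. borel) (\<lambda>(t, c). h t c) (UNIV \<times> links)"

definition level_energy :: "('b::finite, 'k) network \<Rightarrow> real" where
  "level_energy net = capacity net / real (max_level net)"

definition tx_power :: "('b::finite, 'k) network \<Rightarrow> real" where
  "tx_power net = real (tx_levels net) * level_energy net / slot_length net"

definition energy_states :: "('b::finite, 'k) network \<Rightarrow> ('k \<Rightarrow> nat) set" where
  "energy_states net = {s. \<forall>k. s k \<le> max_level net}"

definition able_sources :: "('b::finite, 'k) network \<Rightarrow> ('k \<Rightarrow> nat) \<Rightarrow> 'k set" where
  "able_sources net s = {k. s k \<ge> tx_levels net}"

definition non_tx_states :: "('b::finite, 'k) network \<Rightarrow> ('k \<Rightarrow> nat) set" where
  "non_tx_states net = {s \<in> energy_states net. able_sources net s = {}}"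

text \<open>Below, \<open>g\<close> is the realization of the channels in one slot.\<close>

definition selected_source ::
    "('b::finite, 'k) network \<Rightarrow> (('b, 'k) link \<Rightarrow> complex) \<Rightarrow> ('k \<Rightarrow> nat) \<Rightarrow> 'k" where
  "selected_source net g s = arg_max_on (\<lambda>k. (cmod (g (SD k)))\<^sup>2) (able_sources net s)"

definition harvest_idle ::
    "('b::finite, 'k) network \<Rightarrow> real \<Rightarrow> (('b, 'k) link \<Rightarrow> complex) \<Rightarrow> 'k \<Rightarrow> real" where
  "harvest_idle net P\<^sub>B g k =
     efficiency net * slot_length net * P\<^sub>B * (cmod (tdot (\<chi> b. g (BS b k)) uniform_beam))\<^sup>2"

definition harvest_tx ::
    "('b::finite, 'k) network \<Rightarrow> real \<Rightarrow> (('b, 'k) link \<Rightarrow> complex) \<Rightarrow> 'k \<Rightarrow> 'k \<Rightarrow> real" where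
  "harvest_tx net P\<^sub>B g i k =
     efficiency net * slot_length net *
       (tx_power net * (cmod (g (SS i k)))\<^sup>2 +
        P\<^sub>B * (cmod (tdot (\<chi> b. g (BS b k)) (null_beam net (\<chi> b. g (BD b)))))\<^sup>2)"

definition recharge :: "('b::finite, 'k) network \<Rightarrow> nat \<Rightarrow> real \<Rightarrow> nat" where
  "recharge net l e = min (max_level net) (l + nat \<lfloor>e / level_energy net\<rfloor>)"

definition next_state ::
    "('b::finite, 'k) network \<Rightarrow> real \<Rightarrow> (('b, 'k) link \<Rightarrow> complex) \<Rightarrow> ('k \<Rightarrow> nat) \<Rightarrow> ('k \<Rightarrow> nat)" where
  "next_state net P\<^sub>B g s =
     (if able_sources net s = {}
      then (\<lambda>k. recharge net (s k) (harvest_idle net P\<^sub>B g k))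
      else (let i = selected_source net g s
            in (\<lambda>k. if k = i then s k - tx_levels net
                    else recharge net (s k) (harvest_tx net P\<^sub>B g i k))))"

primrec energy_chain ::
    "('b::finite, 'k) network \<Rightarrow> real \<Rightarrow> (nat \<Rightarrow> ('b, 'k) link \<Rightarrow> 'a \<Rightarrow> complex) \<Rightarrow>
     ('k \<Rightarrow> nat) \<Rightarrow> nat \<Rightarrow> 'a \<Rightarrow> ('k \<Rightarrow> nat)" where
  "energy_chain net P\<^sub>B h s 0 \<omega> = s"
| "energy_chain net P\<^sub>B h s (Suc t) \<omega> =
     next_state net P\<^sub>B (\<lambda>c. h t c \<omega>) (energy_chain net P\<^sub>B h s t \<omega>)"

text \<open>
  The states are enumerated as \<open>\<sigma> n\<close> by a finite index type \<open>'n\<close>.  As the channels of different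
  slots are independent and identically distributed, the energy state is a time-homogeneous
  Markov chain, and its transition matrix is read off from the first slot.
\<close>

definition transition_matrix ::
    "('b::finite, 'k) network \<Rightarrow> 'a measure \<Rightarrow> (nat \<Rightarrow> ('b, 'k) link \<Rightarrow> 'a \<Rightarrow> complex) \<Rightarrow>
     ('n::finite \<Rightarrow> 'k \<Rightarrow> nat) \<Rightarrow> real \<Rightarrow> real ^ 'n ^ 'n" where
  "transition_matrix net M h \<sigma> P\<^sub>B =
     (\<chi> n n'. measure M {\<omega> \<in> space M. energy_chain net P\<^sub>B h (\<sigma> n) 1 \<omega> = \<sigma> n'})"

definition stationary_distribution :: "real ^ 'n ^ 'n \<Rightarrow> real ^ 'n::finite \<Rightarrow> bool" where
  "stationary_distribution T p \<longleftrightarrow>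
     (\<forall>n. 0 \<le> p $ n) \<and> (\<Sum>n\<in>UNIV. p $ n) = 1 \<and> p v* T = p"

definition energy_outage_prob ::
    "('b::finite, 'k) network \<Rightarrow> 'a measure \<Rightarrow> (nat \<Rightarrow> ('b, 'k) link \<Rightarrow> 'a \<Rightarrow> complex) \<Rightarrow>
     ('n::finite \<Rightarrow> 'k \<Rightarrow> nat) \<Rightarrow> real \<Rightarrow> real" where
  "energy_outage_prob net M h \<sigma> P\<^sub>B =
     (\<Sum>n | \<forall>k. \<sigma> n k < tx_levels net.
        (THE p. stationary_distribution (transition_matrix net M h \<sigma> P\<^sub>B) p) $ n)"

end

theory Submission
  imports Defs
begin

text \<open>
  For a stochastic matrix \<open>T\<close> in which some state is reachable from all others, a fixed vector with
  vanishing sum is zero: its positive and its negative part are fixed too and would both charge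
  the common state.  Hence \<open>T\<^sup>T - E + Q\<close> is injective, its inverse maps the all-ones vector to the
  unique stationary distribution, and this distribution depends continuously on \<open>T\<close>.

  As \<open>P\<^sub>B \<rightarrow> \<infinity>\<close>, every harvesting source is almost surely filled up, because its channel from the
  beacon is independent of the beam and has no atoms.  In the limit chain an idle slot thus leads to
  the full state, and a slot in which source \<open>i\<close> transmits leads to the state where all other sources
  are full.  Each of these steps also has positive probability for finite \<open>P\<^sub>B\<close>, and they make some
  state reachable from everywhere.  With at least two sources the limit chain always keeps one of
  them full, so the outage states have stationary mass zero.
\<close>

section \<open>Stationary distributions of stochastic matrices\<close>

lemma matrix_inv:
  fixes A :: "'a::semiring_1 ^ 'n::finite ^ 'm::finite"
  assumes "invertible A"
  shows "A ** matrix_inv A = mat 1" "matrix_inv A ** A = mat 1"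
  using someI_ex[OF assms[unfolded invertible_def]] by (auto simp: matrix_inv_def)

definition stochastic :: "real ^ 'n ^ 'n::finite \<Rightarrow> bool" where
  "stochastic T \<longleftrightarrow> (\<forall>i j. 0 \<le> T $ i $ j) \<and> (\<forall>i. (\<Sum>j\<in>UNIV. T $ i $ j) = 1)"

text \<open>For a stochastic matrix this means that there is a single closed communicating class.
  Transient states and periodicity are allowed, because only stationary vectors are studied, not
  convergence of the chain in time.\<close>

definition rooted :: "real ^ 'n ^ 'n::finite \<Rightarrow> bool" where
  "rooted T \<longleftrightarrow> (\<exists>r. \<forall>i. (i, r) \<in> {(i, j). 0 < T $ i $ j}\<^sup>*)"

lemma vector_matrix_mult_nth:
  fixes v :: "real ^ 'n::finite" and T :: "real ^ 'm ^ 'n"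
  shows "(v v* T) $ j = (\<Sum>i\<in>UNIV. v $ i * T $ i $ j)"
  by (simp add: vector_matrix_mult_def mult.commute)

lemma sum_vector_matrix_mult:
  assumes "stochastic T"
  shows "(\<Sum>j\<in>UNIV. (v v* T) $ j) = (\<Sum>i\<in>UNIV. v $ i)"
proof -
  have "(\<Sum>j\<in>UNIV. (v v* T) $ j) = (\<Sum>i\<in>UNIV. \<Sum>j\<in>UNIV. v $ i * T $ i $ j)"
    unfolding vector_matrix_mult_nth by (rule sum.swap)
  also have "\<dots> = (\<Sum>i\<in>UNIV. v $ i)"
    using assms by (simp add: stochastic_def flip: sum_distrib_left)
  finally show ?thesis .
qed

text \<open>The triangle inequality gives an entrywise bound of \<open>?a\<close> by
  \<open>?a v* T\<close>. Both vectors have the same total because the rows of \<open>T\<close> sum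
  to one, so no entry can be strict.\<close>

lemma fixed_abs:
  fixes v :: "real ^ 'n::finite"
  assumes T: "stochastic T" and v: "v v* T = v"
  shows "(\<chi> i. \<bar>v $ i\<bar>) v* T = (\<chi> i. \<bar>v $ i\<bar>)"
proof -
  let ?a = "(\<chi> i. \<bar>v $ i\<bar>) :: real ^ 'n"
  have le: "?a $ j \<le> (?a v* T) $ j" for j
  proof -
    have "\<bar>v $ j\<bar> = \<bar>\<Sum>i\<in>UNIV. v $ i * T $ i $ j\<bar>"
      using v by (metis vector_matrix_mult_nth)
    also have "\<dots> \<le> (\<Sum>i\<in>UNIV. \<bar>v $ i * T $ i $ j\<bar>)" by (rule sum_abs)
    also have "\<dots> = (?a v* T) $ j"
      using T by (simp add: vector_matrix_mult_nth abs_mult stochastic_def)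
    finally show ?thesis by simp
  qed
  have "(\<Sum>j\<in>UNIV. (?a v* T) $ j - ?a $ j) = 0"
    unfolding sum_subtractf sum_vector_matrix_mult[OF T] by simp
  then have "\<forall>j\<in>UNIV. (?a v* T) $ j - ?a $ j = 0"
    by (subst (asm) sum_nonneg_eq_0_iff) (use le in auto)
  then show ?thesis by (simp add: vec_eq_iff)
qed

text \<open>Stationary mass flows along edges: the inflow into \<open>k\<close> contains the
  positive term coming from \<open>j\<close>, and all other terms are nonnegative.\<close>

lemma fixed_support_closed:
  fixes p :: "real ^ 'n::finite"
  assumes T: "stochastic T" and p: "p v* T = p" "\<And>i. 0 \<le> p $ i"
    and "(i, j) \<in> {(i, j). 0 < T $ i $ j}\<^sup>*" "0 < p $ i"
  shows "0 < p $ j"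
  using assms(4,5)
proof (induction rule: rtrancl_induct)
  case (step j k)
  have "0 < p $ j * T $ j $ k" using step by auto
  also have "\<dots> \<le> (\<Sum>i\<in>UNIV. p $ i * T $ i $ k)"
    by (rule member_le_sum) (use T p in \<open>auto simp: stochastic_def\<close>)
  also have "\<dots> = p $ k" using p by (metis vector_matrix_mult_nth)
  finally show ?case .
qed simp

lemma fixed_sum_zero:
  fixes v :: "real ^ 'n::finite"
  assumes T: "stochastic T" and "rooted T" and v: "v v* T = v" "(\<Sum>i\<in>UNIV. v $ i) = 0"
  shows "v = 0"
proof (rule ccontr)
  assume "v \<noteq> 0"
  obtain r where r: "\<And>i. (i, r) \<in> {(i, j). 0 < T $ i $ j}\<^sup>*"
    using \<open>rooted T\<close> by (auto simp: rooted_def)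
  let ?a = "(\<chi> i. \<bar>v $ i\<bar>) :: real ^ 'n"
  have fixed: "(?a + v) v* T = ?a + v" "(?a - v) v* T = ?a - v"
    using fixed_abs[OF T v(1)] v(1)
    by (simp_all add: vector_matrix_left_distrib vector_matrix_mult_diff_distrib)
  obtain k where k: "v $ k \<noteq> 0" using \<open>v \<noteq> 0\<close> by (auto simp: vec_eq_iff)
  have "\<exists>i. 0 < v $ i"
  proof (rule ccontr)
    assume "\<not> ?thesis"
    then have "\<forall>i\<in>UNIV. - v $ i = 0"
      using v(2) by (subst sum_nonneg_eq_0_iff[symmetric]) (auto simp: sum_negf not_less)
    with k show False by simp
  qed
  then obtain i where "0 < v $ i" ..
  then have "0 < (?a + v) $ r"
    by (intro fixed_support_closed[OF T fixed(1) _ r[of i]]) auto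
  moreover have "\<exists>i. v $ i < 0"
  proof (rule ccontr)
    assume "\<not> ?thesis"
    then have "\<forall>i\<in>UNIV. v $ i = 0"
      using v(2) by (subst sum_nonneg_eq_0_iff[symmetric]) (auto simp: not_less)
    with k show False by simp
  qed
  then obtain j where "v $ j < 0" ..
  then have "0 < (?a - v) $ r"
    by (intro fixed_support_closed[OF T fixed(2) _ r[of j]]) auto
  \<comment> \<open>The entry of \<open>v\<close> at the root would have to be both positive and
    negative.\<close>
  ultimately show False by (simp split: abs_split)
qed

section \<open>The linear system solved by the stationary distribution\<close>

definition stationary_matrix :: "real ^ 'n ^ 'n::finite \<Rightarrow> real ^ 'n ^ 'n" where
  "stationary_matrix T = transpose T - mat 1 + (\<chi> i j. 1)"

lemma stationary_matrix_mult_nth: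
  "(stationary_matrix T *v x) $ j = (x v* T) $ j - x $ j + (\<Sum>i\<in>UNIV. x $ i)"
proof -
  have "((\<chi> i j. 1) *v x) $ j = (\<Sum>i\<in>UNIV. x $ i)"
    by (simp add: matrix_vector_mult_def)
  then show ?thesis
    by (simp add: stationary_matrix_def matrix_vector_mult_add_rdistrib
        matrix_vector_mult_diff_rdistrib)
qed

text \<open>Summing the entries cancels the part from \<open>T\<close> minus the identity and leaves
  only the all-ones matrix. This recovers the total of \<open>x\<close> from the linear system, so
  one system encodes both stationarity and normalization.\<close>

lemma sum_stationary_matrix_mult:
  fixes x :: "real ^ 'n::finite"
  assumes "stochastic T"
  shows "(\<Sum>j\<in>UNIV. (stationary_matrix T *v x) $ j) = real CARD('n) * (\<Sum>i\<in>UNIV. x $ i)"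
  by (simp add: stationary_matrix_mult_nth sum.distrib sum_subtractf
      sum_vector_matrix_mult[OF assms])

text \<open>A kernel vector has total zero by the summed equation. The all-ones part then drops out,
  the vector is fixed by \<open>T\<close>, and \<open>fixed_sum_zero\<close> applies.\<close>

lemma invertible_stationary_matrix:
  assumes T: "stochastic T" "rooted T"
  shows "invertible (stationary_matrix T)"
proof -
  have "x = 0" if x: "stationary_matrix T *v x = 0" for x
  proof -
    have s: "(\<Sum>i\<in>UNIV. x $ i) = 0"
      using sum_stationary_matrix_mult[OF T(1), of x] x by simp
    have "x v* T = x"
      using x s stationary_matrix_mult_nth[of T x] by (simp add: vec_eq_iff)
    with s show ?thesis using fixed_sum_zero[OF T] by blast
  qed
  then show ?thesis
    by (simp add: invertible_left_inverse matrix_left_invertible_ker)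
qed

definition stationary_vector :: "real ^ 'n ^ 'n::finite \<Rightarrow> real ^ 'n" where
  "stationary_vector T = matrix_inv (stationary_matrix T) *v (\<chi> i. 1)"

text \<open>Taking \<open>y = 0\<close> gives uniqueness of the stationary distribution; a small
  \<open>y\<close> gives its continuity in the matrix.\<close>

lemma stationary_matrix_solution:
  assumes T: "stochastic T" "rooted T" and "stationary_matrix T *v x = (\<chi> i. 1) + y"
  shows "x = stationary_vector T + matrix_inv (stationary_matrix T) *v y"
proof -
  have "matrix_inv (stationary_matrix T) ** stationary_matrix T = mat 1"
    by (rule matrix_inv[OF invertible_stationary_matrix[OF T]])
  then have "x = matrix_inv (stationary_matrix T) *v (stationary_matrix T *v x)"
    by (simp add: matrix_vector_mul_assoc)
  then show ?thesis
    by (simp add: assms(3) stationary_vector_def matrix_vector_right_distrib)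
qed

text \<open>Total one and stationarity are read off from the linear system. For nonnegativity, let
  \<open>s\<close> be the sum of the absolute values: the vector of absolute values and
  \<open>s\<close> times the solution are both fixed and have the same total \<open>s\<close>, hence
  they coincide. As \<open>s\<close> is at least 1, no entry can be negative.\<close>

lemma stationary_distribution_stationary_vector:
  fixes T :: "real ^ 'n ^ 'n::finite"
  assumes T: "stochastic T" "rooted T"
  shows "stationary_distribution T (stationary_vector T)"
proof -
  let ?p = "stationary_vector T"
  have "stationary_matrix T ** matrix_inv (stationary_matrix T) = mat 1"
    by (rule matrix_inv[OF invertible_stationary_matrix[OF T]])
  then have Bp: "stationary_matrix T *v ?p = (\<chi> i. 1)"
    by (simp add: stationary_vector_def matrix_vector_mul_assoc)
  then have sum: "(\<Sum>i\<in>UNIV. ?p $ i) = 1"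
    using sum_stationary_matrix_mult[OF T(1), of ?p] by simp
  then have fixed: "?p v* T = ?p"
    using Bp stationary_matrix_mult_nth[of T ?p] by (simp add: vec_eq_iff)
  let ?a = "(\<chi> i. \<bar>?p $ i\<bar>) :: real ^ 'n"
  define s where "s = (\<Sum>i\<in>UNIV. \<bar>?p $ i\<bar>)"
  have "1 \<le> s" unfolding s_def using sum sum_abs[of "\<lambda>i. ?p $ i" UNIV] by linarith
  have "?a - s *s ?p = 0"
  proof (rule fixed_sum_zero[OF T])
    have "(s *s ?p) v* T = s *s (?p v* T)"
      by (simp add: vec_eq_iff vector_matrix_mult_nth sum_distrib_left mult.assoc)
    then show "(?a - s *s ?p) v* T = ?a - s *s ?p"
      by (simp add: vector_matrix_mult_diff_distrib fixed fixed_abs[OF T(1) fixed])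
    show "(\<Sum>i\<in>UNIV. (?a - s *s ?p) $ i) = 0"
      by (simp add: sum_subtractf sum s_def flip: sum_distrib_left)
  qed
  then have "\<bar>?p $ i\<bar> = s * ?p $ i" for i
    by (simp only: vec_eq_iff vector_minus_component vector_smult_component vec_lambda_beta
        zero_index right_minus_eq)
  then have "0 \<le> s * ?p $ i" for i by (metis abs_ge_zero)
  with \<open>1 \<le> s\<close> have "0 \<le> ?p $ i" for i
    using zero_le_mult_iff[of s "?p $ i"] by auto
  with sum fixed show ?thesis by (simp add: stationary_distribution_def)
qed

lemma stationary_distribution_iff:
  assumes T: "stochastic T" "rooted T"
  shows "stationary_distribution T p \<longleftrightarrow> p = stationary_vector T"
proof
  assume p: "stationary_distribution T p"
  have "stationary_matrix T *v p = (\<chi> i. 1) + 0"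
    using p by (simp add: vec_eq_iff stationary_matrix_mult_nth stationary_distribution_def)
  from stationary_matrix_solution[OF T this] show "p = stationary_vector T" by simp
qed (simp add: stationary_distribution_stationary_vector[OF T])

lemma stationary_vector_bounds:
  assumes T: "stochastic T" "rooted T"
  shows "0 \<le> stationary_vector T $ i" "stationary_vector T $ i \<le> 1"
proof -
  have p: "\<And>i. 0 \<le> stationary_vector T $ i" "(\<Sum>i\<in>UNIV. stationary_vector T $ i) = 1"
    using stationary_distribution_stationary_vector[OF T]
    by (auto simp: stationary_distribution_def)
  then show "0 \<le> stationary_vector T $ i" by simp
  show "stationary_vector T $ i \<le> 1"
    using member_le_sum[of i UNIV "\<lambda>i. stationary_vector T $ i"] p by simp
qed

text \<open>Writing \<open>p\<close> for the stationary vector of \<open>T x\<close> and \<open>B\<close> for the stationary matrix of \<open>A\<close>, one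
  has \<open>B p = 1 + (A - T x)\<^sup>T p\<close>, where \<open>p\<close> is bounded; so no continuity of the matrix inverse is
  needed.\<close>

lemma tendsto_stationary_vector:
  fixes A :: "real ^ 'n ^ 'n::finite"
  assumes A: "stochastic A" "rooted A"
    and T: "\<forall>\<^sub>F x in F. stochastic (T x) \<and> rooted (T x)"
    and lim: "\<And>i j. ((\<lambda>x. T x $ i $ j) \<longlongrightarrow> A $ i $ j) F"
  shows "((\<lambda>x. stationary_vector (T x)) \<longlongrightarrow> stationary_vector A) F"
proof -
  define p where "p x = stationary_vector (T x)" for x
  define y where "y x = p x v* (A - T x)" for x
  have "((\<lambda>x. y x $ j) \<longlongrightarrow> 0) F" for j
  proof -
    have "((\<lambda>x. p x $ i * (A - T x) $ i $ j) \<longlongrightarrow> 0) F" for i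
    proof (rule Lim_null_comparison)
      have "((\<lambda>x. \<bar>A $ i $ j - T x $ i $ j\<bar>) \<longlongrightarrow> \<bar>A $ i $ j - A $ i $ j\<bar>) F"
        by (intro tendsto_intros lim)
      then show "((\<lambda>x. \<bar>A $ i $ j - T x $ i $ j\<bar>) \<longlongrightarrow> 0) F" by simp
      show "\<forall>\<^sub>F x in F. norm (p x $ i * (A - T x) $ i $ j) \<le> \<bar>A $ i $ j - T x $ i $ j\<bar>"
        using T
      proof eventually_elim
        case (elim x)
        then show ?case
          using stationary_vector_bounds[of "T x" i]
          by (auto simp: p_def abs_mult intro!: mult_left_le_one_le)
      qed
    qed
    then show ?thesis
      unfolding y_def vector_matrix_mult_nth by (rule tendsto_null_sum)
  qed
  then have "(y \<longlongrightarrow> 0) F" by (intro vec_tendstoI) simp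
  then have "((\<lambda>x. stationary_vector A + matrix_inv (stationary_matrix A) *v y x) \<longlongrightarrow>
      stationary_vector A + matrix_inv (stationary_matrix A) *v 0) F"
    by (intro tendsto_add tendsto_const
        isCont_tendsto_compose[OF linear_continuous_at[OF matrix_vector_mul_bounded_linear]])
  moreover have "\<forall>\<^sub>F x in F. stationary_vector A + matrix_inv (stationary_matrix A) *v y x = p x"
    using T
  proof eventually_elim
    case (elim x)
    then have "stationary_distribution (T x) (p x)"
      by (simp add: p_def stationary_distribution_stationary_vector)
    then have "stationary_matrix A *v p x = (\<chi> i. 1) + y x"
      by (simp add: vec_eq_iff stationary_matrix_mult_nth stationary_distribution_def y_def
          vector_matrix_mult_nth right_diff_distrib sum_subtractf)
    from stationary_matrix_solution[OF A this] show ?case by simp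
  qed
  ultimately show ?thesis
    unfolding p_def by (simp add: tendsto_cong)
qed

section \<open>Transition matrices of random self-maps of a finite state set\<close>

definition kernel_matrix ::
    "'a measure \<Rightarrow> ('n \<Rightarrow> 's) \<Rightarrow> ('a \<Rightarrow> 's \<Rightarrow> 's) \<Rightarrow> real ^ 'n ^ 'n::finite" where
  "kernel_matrix M \<sigma> F = (\<chi> n n'. measure M {\<omega> \<in> space M. F \<omega> (\<sigma> n) = \<sigma> n'})"

text \<open>The image of a state stays in \<open>S\<close>, which \<open>\<sigma>\<close> enumerates
  without repetition, so the events of one row partition the sample space.\<close>

lemma (in prob_space) stochastic_kernel_matrix:
  fixes \<sigma> :: "'n::finite \<Rightarrow> 's"
  assumes \<sigma>: "bij_betw \<sigma> UNIV S"
    and F: "\<And>s \<omega>. s \<in> S \<Longrightarrow> F \<omega> s \<in> S"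
    and ev: "\<And>s s'. {\<omega> \<in> space M. F \<omega> s = s'} \<in> events"
  shows "stochastic (kernel_matrix M \<sigma> F)"
proof -
  have "(\<Sum>n'\<in>UNIV. prob {\<omega> \<in> space M. F \<omega> (\<sigma> n) = \<sigma> n'}) = 1" for n
  proof -
    have "\<sigma> n \<in> S" using \<sigma> by (auto simp: bij_betw_def)
    have "(\<Sum>n'\<in>UNIV. prob {\<omega> \<in> space M. F \<omega> (\<sigma> n) = \<sigma> n'}) =
        prob (\<Union>n'\<in>UNIV. {\<omega> \<in> space M. F \<omega> (\<sigma> n) = \<sigma> n'})"
      using ev \<sigma> by (intro finite_measure_finite_Union[symmetric])
        (auto simp: disjoint_family_on_def bij_betw_def dest: injD)
    also have "(\<Union>n'\<in>UNIV. {\<omega> \<in> space M. F \<omega> (\<sigma> n) = \<sigma> n'}) = space M"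
      using F[OF \<open>\<sigma> n \<in> S\<close>] \<sigma> by (auto simp: bij_betw_def image_iff)
    finally show ?thesis by (simp add: prob_space)
  qed
  then show ?thesis by (simp add: stochastic_def kernel_matrix_def)
qed

section \<open>Measurability and laws without atoms\<close>

text \<open>The maximizer is a Hilbert choice, so ties are resolved in an unknown way. Still, the
  choice depends on \<open>x\<close> only through the strict comparison relation \<open>R x\<close>,
  which takes finitely many values, each on a measurable set.\<close>

lemma measurable_arg_max_on:
  fixes f :: "'i::finite \<Rightarrow> 'a \<Rightarrow> real"
  assumes [measurable]: "\<And>i. f i \<in> borel_measurable M"
  shows "(\<lambda>x. arg_max_on (\<lambda>i. f i x) S) \<in> measurable M (count_space UNIV)"
proof -
  define R where "R x = {(j, i). f i x < f j x}" for x
  define H where "H r = (SOME i. i \<in> S \<and> \<not> (\<exists>j. j \<in> S \<and> (j, i) \<in> r))" for r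
  have "R -` {r} \<inter> space M \<in> sets M" for r
  proof -
    have "R -` {r} \<inter> space M = {x \<in> space M. \<forall>i j. (j, i) \<in> r \<longleftrightarrow> f i x < f j x}"
      by (auto simp: R_def)
    also have "\<dots> \<in> sets M" by measurable
    finally show ?thesis .
  qed
  then have "R \<in> measurable M (count_space UNIV)"
    by (simp add: measurable_count_space_eq2)
  then have "(\<lambda>x. H (R x)) \<in> measurable M (count_space UNIV)"
    by (rule measurable_compose) simp
  then show ?thesis
    by (simp add: R_def H_def arg_max_on_def arg_max_def is_arg_max_def)
qed

lemma arg_max_on_eqI:
  fixes f :: "'i \<Rightarrow> 'b::linorder"
  assumes "x \<in> S" "\<And>y. y \<in> S \<Longrightarrow> y \<noteq> x \<Longrightarrow> f y < f x"
  shows "arg_max_on f S = x"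
  unfolding arg_max_on_def
  by (rule arg_maxI[of _ x]) (use assms in \<open>force simp: not_less\<close>)+

lemma borel_measurable_vec_lambda:
  fixes f :: "'i::finite \<Rightarrow> 'a \<Rightarrow> 'b::euclidean_space"
  assumes [measurable]: "\<And>i. f i \<in> borel_measurable M"
  shows "(\<lambda>x. \<chi> i. f i x) \<in> borel_measurable M"
  by (subst borel_measurable_euclidean_space) (simp add: inner_vec_def)

lemma borel_measurable_vec_nth:
  fixes f :: "'a \<Rightarrow> 'b::euclidean_space ^ 'i::finite"
  assumes "f \<in> borel_measurable M"
  shows "(\<lambda>x. f x $ i) \<in> borel_measurable M"
  by (rule measurable_compose[OF assms])
     (intro borel_measurable_continuous_onI continuous_intros)

text \<open>By independence the joint law is a product. For each fixed value of \<open>Y\<close> the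
  exceptional set for \<open>X\<close> is null, and Fubini makes the exceptional set null for the
  pair.\<close>

lemma (in prob_space) indep_var_atomless_neq:
  fixes p :: "'x \<Rightarrow> 'b::{second_countable_topology, t2_space}"
  assumes indep: "indep_var N X N' Y"
    and p [measurable]: "p \<in> borel_measurable N"
    and atomless: "\<And>c. AE \<omega> in M. p (X \<omega>) \<noteq> c"
    and f [measurable]: "f \<in> borel_measurable N'"
  shows "AE \<omega> in M. p (X \<omega>) \<noteq> f (Y \<omega>)"
proof -
  have [measurable]: "X \<in> measurable M N" "Y \<in> measurable M N'"
    and joint: "distr M N X \<Otimes>\<^sub>M distr M N' Y = distr M (N \<Otimes>\<^sub>M N') (\<lambda>\<omega>. (X \<omega>, Y \<omega>))"
    using indep by (auto simp: indep_var_distribution_eq)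
  interpret X: prob_space "distr M N X" by (rule prob_space_distr) simp
  interpret Y: prob_space "distr M N' Y" by (rule prob_space_distr) simp
  interpret XY: pair_sigma_finite "distr M N X" "distr M N' Y" ..
  have "AE y in distr M N' Y. AE x in distr M N X. p x \<noteq> f y"
    using atomless by (simp add: AE_distr_iff)
  moreover have set: "{z \<in> space (distr M N X \<Otimes>\<^sub>M distr M N' Y). p (fst z) \<noteq> f (snd z)}
      \<in> sets (distr M N X \<Otimes>\<^sub>M distr M N' Y)"
    by measurable
  ultimately have "AE x in distr M N X. AE y in distr M N' Y. p x \<noteq> f y"
    using XY.AE_commute[of "\<lambda>x y. p x \<noteq> f y"] by simp
  with set have "AE z in distr M N X \<Otimes>\<^sub>M distr M N' Y. p (fst z) \<noteq> f (snd z)"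
    by (intro XY.AE_pair_measure) simp_all
  then show ?thesis
    unfolding joint by (simp add: AE_distr_iff space_pair_measure)
qed

text \<open>Indicators that are almost surely eventually equal converge pointwise; dominated
  convergence with bound 1 passes to probabilities.\<close>

lemma (in prob_space) tendsto_prob_eventually:
  fixes E :: "real \<Rightarrow> 'a set"
  assumes [measurable]: "\<And>P. E P \<in> events" "L \<in> events"
    and ev: "AE \<omega> in M. \<forall>\<^sub>F P in at_top. \<omega> \<in> E P \<longleftrightarrow> \<omega> \<in> L"
  shows "((\<lambda>P. prob (E P)) \<longlongrightarrow> prob L) at_top"
proof -
  have "((\<lambda>P. \<integral>\<omega>. indicat_real (E P) \<omega> \<partial>M) \<longlongrightarrow> (\<integral>\<omega>. indicat_real L \<omega> \<partial>M)) at_top"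
  proof (rule integral_dominated_convergence_at_top[where w="\<lambda>_. 1"])
    show "AE \<omega> in M. ((\<lambda>P. indicat_real (E P) \<omega>) \<longlongrightarrow> indicat_real L \<omega>) at_top"
      using ev
    proof eventually_elim
      case (elim \<omega>)
      then have "\<forall>\<^sub>F P in at_top. indicat_real (E P) \<omega> = indicat_real L \<omega>"
        by eventually_elim (simp add: indicator_def)
      then show ?case by (rule tendsto_eventually)
    qed
  qed (auto simp: indicator_def intro!: always_eventually borel_measurable_indicator)
  then show ?thesis by (simp add: Int_absorb2 sets.sets_into_space)
qed

lemma (in prob_space) distributed_lborel_atomless:
  assumes D: "distributed M lborel X f"
  shows "AE \<omega> in M. X \<omega> \<noteq> (c::real)"
proof -
  have [measurable]: "X \<in> borel_measurable M"
    using distributed_measurable[OF D] by simp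
  have "AE x in lborel. x \<noteq> c"
    by (rule AE_lborel_singleton)
  then have "AE x in density lborel f. x \<noteq> c"
    using distributed_borel_measurable[OF D] by (auto simp: AE_density)
  then have "AE x in distr M lborel X. x \<noteq> c"
    unfolding distributed_distr_eq_density[OF D] .
  then show ?thesis
    by (simp add: AE_distr_iff)
qed

text \<open>The density is positive everywhere, so a null tail would make the half-line beyond
  \<open>r\<close>, and hence an interval of length one, Lebesgue null.\<close>

lemma (in prob_space) normal_tail_pos:
  assumes D: "distributed M lborel X (normal_density \<mu> \<sigma>)" and "0 < \<sigma>"
  shows "0 < prob {\<omega> \<in> space M. r < X \<omega>}"
proof (rule ccontr)
  have [measurable]: "X \<in> borel_measurable M"
    using distributed_measurable[OF D] by simp
  assume "\<not> ?thesis"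
  then have "prob {\<omega> \<in> space M. r < X \<omega>} = 0" by (simp add: not_less measure_le_0_iff)
  then have "AE \<omega> in M. \<not> r < X \<omega>"
    by (subst (asm) prob_eq_0) auto
  then have "AE x in distr M lborel X. \<not> r < x"
    by (simp add: AE_distr_iff)
  then have "AE x in lborel. \<not> r < x"
    unfolding distributed_distr_eq_density[OF D]
    using distributed_borel_measurable[OF D] \<open>0 < \<sigma>\<close>
    by (simp add: AE_density normal_density_pos)
  then have "emeasure lborel {r<..<r+1} = 0"
    by (subst AE_iff_measurable[symmetric, where P="\<lambda>x. \<not> (r < x \<and> x < r + 1)" and N="{r<..<r+1}"])
       (auto elim: eventually_mono)
  then show False by simp
qed

section \<open>The limit chain\<close>

lemma finite_UNIV_link: "finite (UNIV :: ('b::finite, 'k::finite) link set)"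
proof -
  have "(UNIV :: ('b, 'k) link set) =
      (\<lambda>(b, k). BS b k) ` UNIV \<union> range BD \<union> range SD \<union> (\<lambda>(i, k). SS i k) ` UNIV"
    by (auto simp: image_iff) (metis link.exhaust)
  then show ?thesis by (metis finite_UnI finite_imageI finite)
qed

lemma links_simps [simp]:
  "BS b k \<in> links" "BD b \<in> links" "SD k \<in> links" "SS i k \<in> links \<longleftrightarrow> i \<noteq> k"
  by (auto simp: links_def)

section \<open>Limit dynamics and its graph of steps\<close>

definition full_state :: "('b::finite, 'k) network \<Rightarrow> 'k \<Rightarrow> nat" where
  "full_state net = (\<lambda>k. max_level net)"

text \<open>The outcome at infinite beacon power, where every listening source is full. The natural
  subtraction truncates only if \<open>i\<close> is not able to transmit.\<close>

definition state_after_tx :: "('b::finite, 'k) network \<Rightarrow> ('k \<Rightarrow> nat) \<Rightarrow> 'k \<Rightarrow> 'k \<Rightarrow> nat" where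
  "state_after_tx net s i = (full_state net)(i := s i - tx_levels net)"

definition limit_next_state ::
    "('b::finite, 'k) network \<Rightarrow> (('b, 'k) link \<Rightarrow> complex) \<Rightarrow> ('k \<Rightarrow> nat) \<Rightarrow> 'k \<Rightarrow> nat" where
  "limit_next_state net g s =
     (if able_sources net s = {} then full_state net
      else state_after_tx net s (selected_source net g s))"

text \<open>A graph without probabilities, which makes reachability a combinatorial matter. Each
  edge is shown later to have positive probability both in the limit and at every positive beacon
  power.\<close>

definition limit_steps :: "('b::finite, 'k) network \<Rightarrow> (('k \<Rightarrow> nat) \<times> ('k \<Rightarrow> nat)) set" where
  "limit_steps net = {(s, s'). s \<in> energy_states net \<and>
     (if able_sources net s = {} then s' = full_state net
      else \<exists>i \<in> able_sources net s. s' = state_after_tx net s i)}"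

lemma full_state_in: "full_state net \<in> energy_states net"
  by (simp add: full_state_def energy_states_def)

lemma state_after_tx_in: "s \<in> energy_states net \<Longrightarrow> state_after_tx net s i \<in> energy_states net"
  by (auto simp: full_state_def state_after_tx_def energy_states_def intro: le_trans[OF diff_le_self])

lemma limit_steps_in: "(s, s') \<in> limit_steps net \<Longrightarrow> s' \<in> energy_states net"
  by (auto simp: limit_steps_def full_state_in state_after_tx_in split: if_splits)

lemma limit_next_state_in:
  "s \<in> energy_states net \<Longrightarrow> limit_next_state net g s \<in> energy_states net"
  by (simp add: limit_next_state_def full_state_in state_after_tx_in)

lemma next_state_in: "s \<in> energy_states net \<Longrightarrow> next_state net P g s \<in> energy_states net"
  by (auto simp: next_state_def Let_def energy_states_def recharge_def
      intro: le_trans[OF diff_le_self])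

text \<open>After an idle slot all sources are full; after a transmission some source other than the
  transmitter exists and is full. A full source can transmit.\<close>

lemma limit_next_state_able:
  fixes net :: "('b::finite, 'k::finite) network"
  assumes "tx_levels net \<le> max_level net" "CARD('k) \<noteq> 1"
  shows "able_sources net (limit_next_state net g s) \<noteq> {}"
proof (cases "able_sources net s = {}")
  case True
  then show ?thesis
    using assms by (simp add: limit_next_state_def able_sources_def full_state_def)
next
  case False
  let ?i = "selected_source net g s"
  obtain j where "j \<noteq> ?i"
    using \<open>CARD('k) \<noteq> 1\<close> by (metis UNIV_eq_I is_singletonI is_singleton_altdef singletonI)
  then have "j \<in> able_sources net (limit_next_state net g s)"
    using False assms
    by (simp add: limit_next_state_def able_sources_def full_state_def state_after_tx_def)
  then show ?thesis by blast
qed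

text \<open>With one source, it transmits until it is drained below the threshold, and the next idle
  slot fills it. With more, fix a source \<open>i\<close>; the root is the state left behind when
  \<open>i\<close> transmits from full charge. An idle slot, or a transmission by any other source,
  makes \<open>i\<close> full, one step before the root.\<close>

lemma limit_steps_root:
  fixes net :: "('b::finite, 'k::finite) network"
  assumes l: "1 \<le> tx_levels net" "tx_levels net \<le> max_level net"
  obtains r where "r \<in> energy_states net"
    "\<And>s. s \<in> energy_states net \<Longrightarrow> (s, r) \<in> (limit_steps net)\<^sup>*"
proof -
  let ?E = "limit_steps net" and ?L = "max_level net" and ?l = "tx_levels net"
  have idle: "(s, full_state net) \<in> ?E\<^sup>*"
    if "s \<in> energy_states net" "able_sources net s = {}" for s
    using that by (auto simp: limit_steps_def)
  have tx: "(s, state_after_tx net s i) \<in> ?E"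
    if "s \<in> energy_states net" "?l \<le> s i" for s i
    using that by (auto simp: limit_steps_def able_sources_def)
  show ?thesis
  proof (cases "CARD('k) = 1")
    case True
    then obtain i :: 'k where i: "\<And>k. k = i" by (metis card_1_singletonE UNIV_I singletonD)
    have "(s, full_state net) \<in> ?E\<^sup>*" if "s \<in> energy_states net" for s
      using that
    \<comment> \<open>The level strictly decreases with each transmission because at least one
      energy level is spent.\<close>
    proof (induction "s i" arbitrary: s rule: less_induct)
      case less
      show ?case
      proof (cases "?l \<le> s i")
        case True
        have "(state_after_tx net s i, full_state net) \<in> ?E\<^sup>*"
          by (rule less.hyps)
             (use True l in \<open>simp_all add: state_after_tx_in[OF less.prems],
                 simp add: state_after_tx_def\<close>)
        with tx[OF less.prems True] show ?thesis by (rule converse_rtrancl_into_rtrancl)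
      next
        case False
        then have "\<not> ?l \<le> s k" for k using i[of k] by simp
        then have "able_sources net s = {}" by (simp add: able_sources_def)
        then show ?thesis using idle less.prems by blast
      qed
    qed
    then show ?thesis using that full_state_in by blast
  next
    case False
    fix i :: 'k
    obtain j where "j \<noteq> i"
      using False by (metis UNIV_eq_I is_singletonI is_singleton_altdef singletonI)
    define r where "r = (full_state net)(i := ?L - ?l)"
    have toR: "(s, r) \<in> ?E" if "s \<in> energy_states net" "s i = ?L" for s
      using tx[of s i] that l by (simp add: r_def state_after_tx_def)
    have tx_other: "(s, r) \<in> ?E\<^sup>*"
      if s: "s \<in> energy_states net" "?l \<le> s m" "m \<noteq> i" for s m
    proof -
      have "(state_after_tx net s m, r) \<in> ?E"
        by (rule toR) (use s in \<open>auto simp: state_after_tx_in\<close>,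
              simp add: state_after_tx_def full_state_def)
      then show ?thesis using tx[OF s(1,2)] by (meson converse_rtrancl_into_rtrancl r_into_rtrancl)
    qed
    have "(s, r) \<in> ?E\<^sup>*" if s: "s \<in> energy_states net" for s
    proof (cases "able_sources net s = {}")
      case True
      have "(full_state net, r) \<in> ?E"
        by (rule toR) (simp_all add: full_state_in, simp add: full_state_def)
      with idle[OF s True] show ?thesis by (rule rtrancl_into_rtrancl)
    next
      case False
      then obtain m where m: "?l \<le> s m" by (auto simp: able_sources_def)
      show ?thesis
      proof (cases "m = i")
        case True
        \<comment> \<open>A transmission by \<open>i\<close> leaves \<open>j\<close> full, so
          \<open>j\<close> can transmit next; this fills \<open>i\<close> and reduces to the
          previous case.\<close>
        have "(state_after_tx net s i, r) \<in> ?E\<^sup>*"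
          using \<open>j \<noteq> i\<close> s l
          by (intro tx_other[of _ j]) (auto simp: state_after_tx_in,
                simp add: state_after_tx_def full_state_def)
        then show ?thesis using tx[of s i] s m True by (meson converse_rtrancl_into_rtrancl)
      next
        case False
        then show ?thesis using tx_other s m by blast
      qed
    qed
    moreover have "r \<in> energy_states net"
      by (auto simp: r_def energy_states_def full_state_def)
    ultimately show ?thesis using that by blast
  qed
qed

text \<open>Only positivity on the edges of \<open>limit_steps\<close> is asked for, so the lemma
  serves the limit matrix as well as the matrices at finite power, which may have further positive
  entries.\<close>

lemma rooted_if_limit_steps_pos:
  fixes \<sigma> :: "'n::finite \<Rightarrow> 'k::finite \<Rightarrow> nat" and net :: "('b::finite, 'k) network"
  assumes \<sigma>: "bij_betw \<sigma> UNIV (energy_states net)"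
    and l: "1 \<le> tx_levels net" "tx_levels net \<le> max_level net"
    and pos: "\<And>n n'. (\<sigma> n, \<sigma> n') \<in> limit_steps net \<Longrightarrow> 0 < T $ n $ n'"
  shows "rooted T"
proof -
  obtain r where r: "r \<in> energy_states net"
    "\<And>s. s \<in> energy_states net \<Longrightarrow> (s, r) \<in> (limit_steps net)\<^sup>*"
    using limit_steps_root[OF l] by blast
  have inv: "\<sigma> (inv \<sigma> s) = s" if "s \<in> energy_states net" for s
    using that \<sigma> by (metis bij_betw_def f_inv_into_f)
  have step: "(inv \<sigma> s, inv \<sigma> s') \<in> {(i, j). 0 < T $ i $ j}" if "(s, s') \<in> limit_steps net" for s s'
  proof -
    have "s \<in> energy_states net" "s' \<in> energy_states net"
      using that limit_steps_in[OF that] by (auto simp: limit_steps_def)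
    then show ?thesis using that pos[of "inv \<sigma> s" "inv \<sigma> s'"] by (simp add: inv)
  qed
  have steps: "(inv \<sigma> s, inv \<sigma> s') \<in> {(i, j). 0 < T $ i $ j}\<^sup>*"
    if "(s, s') \<in> (limit_steps net)\<^sup>*" for s s'
    using that by (induction rule: rtrancl_induct) (simp, metis step rtrancl_into_rtrancl)
  have "(n, inv \<sigma> r) \<in> {(i, j). 0 < T $ i $ j}\<^sup>*" for n
  proof -
    have "\<sigma> n \<in> energy_states net" using \<sigma> by (auto simp: bij_betw_def)
    from steps[OF r(2)[OF this]] show ?thesis using \<sigma> by (simp add: bij_betw_def inv_f_f)
  qed
  then show ?thesis unfolding rooted_def by blast
qed

section \<open>One slot of the network\<close>

lemma next_state_idle:
  "able_sources net s = {} \<Longrightarrow>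
    next_state net P g s = (\<lambda>k. recharge net (s k) (harvest_idle net P g k))"
  by (simp add: next_state_def)

lemma next_state_tx:
  "able_sources net s \<noteq> {} \<Longrightarrow>
    next_state net P g s = (\<lambda>k. if k = selected_source net g s then s k - tx_levels net
      else recharge net (s k) (harvest_tx net P g (selected_source net g s) k))"
  by (simp add: next_state_def Let_def)

lemma measurable_recharge:
  assumes [measurable]: "f \<in> borel_measurable M"
  shows "(\<lambda>x. recharge net l (f x)) \<in> measurable M (count_space UNIV)"
  unfolding recharge_def by measurable

text \<open>The real parts add up coherently: the sum is at least \<open>C\<close> times the square
  root of the number of antennas.\<close>

lemma tdot_uniform_beam_ge:
  fixes v :: "complex ^ 'b::finite"
  assumes "\<And>b. C \<le> Re (v $ b)" "0 \<le> C"
  shows "C \<le> cmod (tdot v uniform_beam)"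
proof -
  let ?N = "real CARD('b)"
  have "C = C * 1" by simp
  also have "\<dots> \<le> C * sqrt ?N"
    using \<open>0 \<le> C\<close> by (intro mult_left_mono) (simp_all add: Suc_le_eq)
  also have "\<dots> = (\<Sum>b\<in>(UNIV::'b set). C / sqrt ?N)"
    by (simp add: field_simps)
  also have "\<dots> \<le> (\<Sum>b\<in>UNIV. Re (v $ b) / sqrt ?N)"
    using assms by (intro sum_mono divide_right_mono) auto
  also have "\<dots> = Re (tdot v uniform_beam)"
    by (simp add: tdot_def uniform_beam_def Re_divide_of_real flip: of_real_divide)
  also have "\<dots> \<le> cmod (tdot v uniform_beam)" by (rule complex_Re_le_cmod)
  finally show ?thesis .
qed

context beacon_network
begin

lemma level_energy_pos: "0 < level_energy net"
  using capacity_pos tx_levels_pos tx_levels_le by (simp add: level_energy_def)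

lemma tx_power_pos: "0 < tx_power net"
  using level_energy_pos slot_length_pos tx_levels_pos by (simp add: tx_power_def)

lemma recharge_full:
  assumes "real (max_level net) * level_energy net \<le> e"
  shows "recharge net l e = max_level net"
proof -
  have "real (max_level net) \<le> e / level_energy net"
    using assms level_energy_pos by (simp add: field_simps)
  then have "max_level net \<le> nat \<lfloor>e / level_energy net\<rfloor>" by (simp add: le_nat_floor)
  then show ?thesis by (simp add: recharge_def)
qed

section \<open>Measurability of the slot dynamics\<close>

lemma borel_measurable_channel [measurable]:
  "c \<in> links \<Longrightarrow> h t c \<in> borel_measurable M"
  using channels_indep unfolding indep_vars_def2 by auto

lemma measurable_selected_source [measurable]:
  "(\<lambda>\<omega>. selected_source net (\<lambda>c. h t c \<omega>) s) \<in> measurable M (count_space UNIV)"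
  unfolding selected_source_def by (rule measurable_arg_max_on) simp

lemma borel_measurable_harvest_idle [measurable]:
  "(\<lambda>\<omega>. harvest_idle net P (\<lambda>c. h t c \<omega>) k) \<in> borel_measurable M"
  unfolding harvest_idle_def tdot_def by simp

text \<open>The case \<open>i = k\<close> is excluded because the self-link \<open>SS i i\<close>
  lies outside \<open>links\<close>, so nothing is known about its coefficient.\<close>

lemma borel_measurable_harvest_tx:
  assumes "i \<noteq> k"
  shows "(\<lambda>\<omega>. harvest_tx net P (\<lambda>c. h t c \<omega>) i k) \<in> borel_measurable M"
proof -
  have [measurable]: "(\<lambda>\<omega>. null_beam net (\<chi> b. h t (BD b) \<omega>) $ b') \<in> borel_measurable M" for b'
    by (intro borel_measurable_vec_nth measurable_compose[OF _ null_beam_measurable]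
        borel_measurable_vec_lambda) simp
  have [measurable]: "h t (SS i k) \<in> borel_measurable M" using assms by simp
  show ?thesis
    unfolding harvest_tx_def tdot_def by simp
qed

lemma next_state_event:
  "{\<omega> \<in> space M. next_state net P (\<lambda>c. h t c \<omega>) s = s'} \<in> events"
proof (cases "able_sources net s = {}")
  case True
  note [measurable] = measurable_recharge
  have "{\<omega> \<in> space M. \<forall>k. recharge net (s k) (harvest_idle net P (\<lambda>c. h t c \<omega>) k) = s' k} \<in> events"
    by measurable
  then show ?thesis
    unfolding next_state_idle[OF True] fun_eq_iff .
next
  case False
  have *: "{\<omega> \<in> space M. (if k = i then s k - tx_levels net
      else recharge net (s k) (harvest_tx net P (\<lambda>c. h t c \<omega>) i k)) = s' k} \<in> events" for i k
  proof (cases "k = i")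
    case neq: False
    then have [measurable]: "(\<lambda>\<omega>. recharge net (s k) (harvest_tx net P (\<lambda>c. h t c \<omega>) i k))
        \<in> measurable M (count_space UNIV)"
      by (intro measurable_recharge borel_measurable_harvest_tx) simp
    from neq show ?thesis by simp
  qed simp
  have [measurable]: "Measurable.pred M (\<lambda>\<omega>. (if k = i then s k - tx_levels net
      else recharge net (s k) (harvest_tx net P (\<lambda>c. h t c \<omega>) i k)) = s' k)" for i k
    using * unfolding pred_def .
  \<comment> \<open>Quantifying over the finitely many possible transmitters fixes \<open>i\<close>,
    and the conditional keeps the self-link out of the harvested energy.\<close>
  have "{\<omega> \<in> space M. \<forall>i. selected_source net (\<lambda>c. h t c \<omega>) s = i \<longrightarrow>
      (\<forall>k. (if k = i then s k - tx_levels net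
        else recharge net (s k) (harvest_tx net P (\<lambda>c. h t c \<omega>) i k)) = s' k)} \<in> events"
    by measurable
  then show ?thesis
    unfolding next_state_tx[OF False] fun_eq_iff by simp
qed

lemma limit_next_state_event:
  "{\<omega> \<in> space M. limit_next_state net (\<lambda>c. h t c \<omega>) s = s'} \<in> events"
proof -
  have "(\<lambda>\<omega>. if able_sources net s = {} then full_state net
      else state_after_tx net s (selected_source net (\<lambda>c. h t c \<omega>) s))
      \<in> measurable M (count_space UNIV)"
    by (intro measurable_If measurable_compose[OF measurable_selected_source]) auto
  then have [measurable]: "(\<lambda>\<omega>. limit_next_state net (\<lambda>c. h t c \<omega>) s)
      \<in> measurable M (count_space UNIV)"
    unfolding limit_next_state_def .
  show ?thesis by measurable
qed

section \<open>Slot events of positive probability\<close>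

lemma prob_channels_pos:
  assumes J: "J \<subseteq> links" and A: "\<And>c. c \<in> J \<Longrightarrow> A c \<in> sets borel"
    and pos: "\<And>c. c \<in> J \<Longrightarrow> 0 < prob {\<omega> \<in> space M. h t c \<omega> \<in> A c}"
  shows "0 < prob {\<omega> \<in> space M. \<forall>c\<in>J. h t c \<omega> \<in> A c}"
\<comment> \<open>The product rule for independent variables requires a nonempty index set.\<close>
proof (cases "J = {}")
  case True
  then show ?thesis by (simp add: prob_space)
next
  case False
  have "finite J" by (rule finite_subset[OF subset_UNIV finite_UNIV_link])
  have "prob (\<Inter>x\<in>Pair t ` J. (case x of (t, c) \<Rightarrow> h t c) -` A (snd x) \<inter> space M) =
      (\<Prod>x\<in>Pair t ` J. prob ((case x of (t, c) \<Rightarrow> h t c) -` A (snd x) \<inter> space M))"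
    by (rule indep_varsD[OF channels_indep]) (use False \<open>finite J\<close> J A in auto)
  moreover have "(\<Inter>x\<in>Pair t ` J. (case x of (t, c) \<Rightarrow> h t c) -` A (snd x) \<inter> space M) =
      {\<omega> \<in> space M. \<forall>c\<in>J. h t c \<omega> \<in> A c}"
    using False by auto
  moreover have "0 < (\<Prod>x\<in>Pair t ` J. prob ((case x of (t, c) \<Rightarrow> h t c) -` A (snd x) \<inter> space M))"
    using pos by (intro prod_pos) (auto simp: vimage_def Int_def conj_commute)
  ultimately show ?thesis by simp
qed

lemma distributed_Re_channel:
  "c \<in> links \<Longrightarrow>
    distributed M lborel (\<lambda>\<omega>. Re (h t c \<omega>)) (normal_density 0 (sqrt (mean_gain net c / 2)))"
  using channels_gaussian by (simp add: circ_complex_gaussian_def)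

lemma prob_Re_channel_pos: "c \<in> links \<Longrightarrow> 0 < prob {\<omega> \<in> space M. h t c \<omega> \<in> {z. r < Re z}}"
  using normal_tail_pos[OF distributed_Re_channel] mean_gain_pos by simp

lemma channel_atomless:
  assumes "c \<in> links"
  shows "AE \<omega> in M. h t c \<omega> \<noteq> z"
  using distributed_lborel_atomless[OF distributed_Re_channel[OF assms, of t], of "Re z"]
  by eventually_elim auto

text \<open>The probability tends to one as \<open>r\<close> grows, hence is eventually positive;
  the law of the modulus need not be computed.\<close>

lemma channel_bounded_pos:
  assumes [simp]: "c \<in> links"
  shows "\<forall>\<^sub>F r in at_top. 0 < prob {\<omega> \<in> space M. h t c \<omega> \<in> {z. cmod z \<le> r}}"
proof -
  have "((\<lambda>r. prob {\<omega> \<in> space M. h t c \<omega> \<in> {z. cmod z \<le> r}}) \<longlongrightarrow> prob (space M)) at_top"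
  proof (rule tendsto_prob_eventually)
    show "AE \<omega> in M. \<forall>\<^sub>F r in at_top.
        \<omega> \<in> {\<omega> \<in> space M. h t c \<omega> \<in> {z. cmod z \<le> r}} \<longleftrightarrow> \<omega> \<in> space M"
    proof (rule AE_I2)
      fix \<omega>
      show "\<forall>\<^sub>F r in at_top.
          \<omega> \<in> {\<omega> \<in> space M. h t c \<omega> \<in> {z. cmod z \<le> r}} \<longleftrightarrow> \<omega> \<in> space M"
        using eventually_ge_at_top[of "cmod (h t c \<omega>)"] by eventually_elim simp
    qed
  qed simp_all
  then show ?thesis by (rule order_tendstoD) (simp add: prob_space)
qed

lemma prob_idle_event_pos:
  "0 < prob {\<omega> \<in> space M. \<forall>b k. C < Re (h t (BS b k) \<omega>)}"
proof -
  have "0 < prob {\<omega> \<in> space M. \<forall>c\<in>(\<lambda>(b, k). BS b k) ` UNIV. h t c \<omega> \<in> {z. C < Re z}}"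
    by (rule prob_channels_pos) (auto simp: prob_Re_channel_pos[simplified])
  then show ?thesis by simp
qed

text \<open>Filling up the listening sources through the source-to-source links alone keeps the beam, which
  depends on the channels to the destination, out of the argument.\<close>

lemma prob_tx_event_pos:
  assumes i: "i \<in> able_sources net s"
  obtains E where "E \<subseteq> space M" "0 < prob E"
    "\<And>\<omega>. \<omega> \<in> E \<Longrightarrow> selected_source net (\<lambda>c. h t c \<omega>) s = i"
    "\<And>\<omega> k. \<omega> \<in> E \<Longrightarrow> k \<noteq> i \<Longrightarrow> C < cmod (h t (SS i k) \<omega>)"
proof -
  have "\<forall>\<^sub>F r in at_top. \<forall>k. 0 < prob {\<omega> \<in> space M. h t (SD k) \<omega> \<in> {z. cmod z \<le> r}}"
    by (simp add: eventually_all_finite channel_bounded_pos[simplified])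
  then have "\<forall>\<^sub>F r in at_top. 0 \<le> r \<and> (\<forall>k. 0 < prob {\<omega> \<in> space M. h t (SD k) \<omega> \<in> {z. cmod z \<le> r}})"
    by (intro eventually_conj eventually_ge_at_top)
  then obtain r where r: "0 \<le> r" "\<And>k. 0 < prob {\<omega> \<in> space M. h t (SD k) \<omega> \<in> {z. cmod z \<le> r}}"
    by (auto dest: eventually_happens)
  define J :: "('b, 'k) link set" where "J = range SD \<union> SS i ` (- {i})"
  \<comment> \<open>On this event \<open>r\<close> separates the links to the destination: that of
    \<open>i\<close> exceeds it in modulus and all others stay within it, so \<open>i\<close> is the
    strict maximizer and the selection is free of ties.\<close>
  define A where "A c = (case c of SD k \<Rightarrow> if k = i then {z. r < Re z} else {z. cmod z \<le> r}
    | _ \<Rightarrow> {z. C < Re z})" for c :: "('b, 'k) link"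
  define E where "E = {\<omega> \<in> space M. \<forall>c\<in>J. h t c \<omega> \<in> A c}"
  have "0 < prob E"
    unfolding E_def
  proof (rule prob_channels_pos)
    show "J \<subseteq> links" by (auto simp: J_def)
    then show "0 < prob {\<omega> \<in> space M. h t c \<omega> \<in> A c}" if "c \<in> J" for c
      using that r prob_Re_channel_pos[of c] by (auto simp: A_def split: link.split)
    show "A c \<in> sets borel" for c by (simp add: A_def split: link.split)
  qed
  moreover have "selected_source net (\<lambda>c. h t c \<omega>) s = i" if "\<omega> \<in> E" for \<omega>
    unfolding selected_source_def
  proof (rule arg_max_on_eqI[OF i])
    fix k assume "k \<noteq> i"
    have "h t (SD c) \<omega> \<in> A (SD c)" for c using that by (simp add: E_def J_def)
    from this[of k] this[of i] \<open>k \<noteq> i\<close> have "cmod (h t (SD k) \<omega>) \<le> r" "r < Re (h t (SD i) \<omega>)"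
      by (auto simp: A_def)
    then have "cmod (h t (SD k) \<omega>) < cmod (h t (SD i) \<omega>)"
      using complex_Re_le_cmod[of "h t (SD i) \<omega>"] by linarith
    then show "(cmod (h t (SD k) \<omega>))\<^sup>2 < (cmod (h t (SD i) \<omega>))\<^sup>2"
      by (intro power_strict_mono) auto
  qed
  moreover have "C < cmod (h t (SS i k) \<omega>)" if "\<omega> \<in> E" "k \<noteq> i" for \<omega> k
  proof -
    have "h t (SS i k) \<omega> \<in> A (SS i k)" using that by (simp add: E_def J_def)
    then have "C < Re (h t (SS i k) \<omega>)" by (auto simp: A_def)
    then show ?thesis using complex_Re_le_cmod[of "h t (SS i k) \<omega>"] by linarith
  qed
  ultimately show ?thesis using that[of E] by (auto simp: E_def)
qed

lemma limit_step_prob_pos: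
  assumes "(s, s') \<in> limit_steps net"
  shows "0 < prob {\<omega> \<in> space M. limit_next_state net (\<lambda>c. h t c \<omega>) s = s'}"
proof (cases "able_sources net s = {}")
  case True
  with assms show ?thesis by (simp add: limit_steps_def limit_next_state_def prob_space)
next
  case False
  then obtain i where i: "i \<in> able_sources net s" "s' = state_after_tx net s i"
    using assms by (auto simp: limit_steps_def)
  from prob_tx_event_pos[OF i(1), of t 0] obtain E where E: "E \<subseteq> space M" "0 < prob E"
    "\<And>\<omega>. \<omega> \<in> E \<Longrightarrow> selected_source net (\<lambda>c. h t c \<omega>) s = i" by metis
  note E(2)
  also have "prob E \<le> prob {\<omega> \<in> space M. limit_next_state net (\<lambda>c. h t c \<omega>) s = s'}"
    by (rule finite_measure_mono[OF _ limit_next_state_event])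
       (use E(1,3) False i in \<open>auto simp: limit_next_state_def\<close>)
  finally show ?thesis .
qed

text \<open>Gaussian gains are unbounded, so at any positive power a single slot can fill all
  listeners: through the beacon links in an idle slot, through the links from the transmitter
  otherwise.\<close>

lemma next_step_prob_pos:
  assumes "(s, s') \<in> limit_steps net" "0 < P"
  shows "0 < prob {\<omega> \<in> space M. next_state net P (\<lambda>c. h t c \<omega>) s = s'}"
proof -
  let ?a = "efficiency net * slot_length net" and ?C = "real (max_level net) * level_energy net"
  have a: "0 < ?a" using efficiency_pos slot_length_pos by simp
  \<comment> \<open>The maximum with 1 ensures that \<open>x\<close> is at most its square, which
    avoids square roots. \<open>Q\<close> will be the beacon power in an idle slot and
    \<open>tx_power net\<close> in a transmission slot.\<close>
  have bound: "?C \<le> ?a * Q * x\<^sup>2" if "0 < Q" "max 1 (?C / (?a * Q)) \<le> x" for Q x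
  proof -
    have "x * 1 \<le> x * x" using that by (intro mult_left_mono) auto
    then have "x \<le> x\<^sup>2" by (simp only: power2_eq_square mult_1_right)
    then have "?C / (?a * Q) \<le> x\<^sup>2" using that by simp
    then show ?thesis using a \<open>0 < Q\<close> by (simp add: field_simps)
  qed
  show ?thesis
  proof (cases "able_sources net s = {}")
    case True
    have s': "s' = full_state net" using assms True by (simp add: limit_steps_def)
    let ?x = "max 1 (?C / (?a * P))"
    have "0 < prob {\<omega> \<in> space M. \<forall>b k. ?x < Re (h t (BS b k) \<omega>)}" by (rule prob_idle_event_pos)
    also have "\<dots> \<le> prob {\<omega> \<in> space M. next_state net P (\<lambda>c. h t c \<omega>) s = s'}"
    proof (rule finite_measure_mono[OF _ next_state_event], safe)
      fix \<omega> assume *: "\<forall>b k. ?x < Re (h t (BS b k) \<omega>)"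
      have "?C \<le> harvest_idle net P (\<lambda>c. h t c \<omega>) k" for k
        unfolding harvest_idle_def
        by (intro bound assms tdot_uniform_beam_ge) (use * in \<open>auto intro: less_imp_le\<close>)
      then show "next_state net P (\<lambda>c. h t c \<omega>) s = s'"
        by (simp add: next_state_idle[OF True] s' full_state_def recharge_full)
    qed
    finally show ?thesis .
  next
    case False
    then obtain i where i: "i \<in> able_sources net s" "s' = state_after_tx net s i"
      using assms by (auto simp: limit_steps_def)
    let ?x = "max 1 (?C / (?a * tx_power net))"
    from prob_tx_event_pos[OF i(1), of t ?x] obtain E where E: "E \<subseteq> space M" "0 < prob E"
      "\<And>\<omega>. \<omega> \<in> E \<Longrightarrow> selected_source net (\<lambda>c. h t c \<omega>) s = i"
      "\<And>\<omega> k. \<omega> \<in> E \<Longrightarrow> k \<noteq> i \<Longrightarrow> ?x < cmod (h t (SS i k) \<omega>)" by metis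
    note E(2)
    also have "prob E \<le> prob {\<omega> \<in> space M. next_state net P (\<lambda>c. h t c \<omega>) s = s'}"
    proof (rule finite_measure_mono[OF _ next_state_event], safe)
      fix \<omega> assume \<omega>: "\<omega> \<in> E"
      then show "\<omega> \<in> space M" using E(1) by blast
      have "?C \<le> harvest_tx net P (\<lambda>c. h t c \<omega>) i k" if "k \<noteq> i" for k
      proof -
        have "?C \<le> ?a * tx_power net * (cmod (h t (SS i k) \<omega>))\<^sup>2"
          by (intro bound tx_power_pos) (use E(4)[OF \<omega> that] in simp)
        \<comment> \<open>The contribution of the beacon is nonnegative and is dropped.\<close>
        also have "\<dots> \<le> harvest_tx net P (\<lambda>c. h t c \<omega>) i k"
          using a assms(2) by (simp add: harvest_tx_def distrib_left)
        finally show ?thesis .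
      qed
      then show "next_state net P (\<lambda>c. h t c \<omega>) s = s'"
        using E(3)[OF \<omega>]
        by (auto simp: next_state_tx[OF False] i(2) state_after_tx_def full_state_def recharge_full)
    qed
    finally show ?thesis .
  qed
qed

text \<open>Where entry \<open>b\<close> of the beam is nonzero, the product vanishes only if the
  coefficient of \<open>BS b k\<close> equals a value computed from the other coefficients of the
  slot. Those are independent of it and its law has no atoms, so this is a null event. A
  nonvanishing beam has such an entry at every sample point.\<close>

lemma AE_tdot_neq_0:
  assumes W [measurable]: "W \<in> borel_measurable borel" and W0: "\<And>v. W v \<noteq> 0"
  shows "AE \<omega> in M. tdot (\<chi> b. h t (BS b k) \<omega>) (W (\<chi> b. h t (BD b) \<omega>)) \<noteq> 0"
proof -
  let ?v = "\<lambda>\<omega>. \<chi> b. h t (BS b k) \<omega>" and ?w = "\<lambda>\<omega>. W (\<chi> b. h t (BD b) \<omega>)"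
  have "AE \<omega> in M. ?w \<omega> $ b \<noteq> 0 \<longrightarrow> tdot (?v \<omega>) (?w \<omega>) \<noteq> 0" for b
  proof -
    let ?c = "(t, BS b k)"
    let ?B = "{t} \<times> (links - {BS b k})"
    let ?N = "PiM ?B (\<lambda>_. borel) :: (nat \<times> ('b, 'k) link \<Rightarrow> complex) measure"
    let ?Y = "\<lambda>\<omega>. restrict (\<lambda>i. (case i of (t, c) \<Rightarrow> h t c) \<omega>) ?B"
    \<comment> \<open>This solves the vanishing of the product for the coefficient of
      \<open>BS b k\<close>. The links \<open>BD\<close> belong to \<open>?B\<close>, so the beam is
      a function of \<open>?Y\<close>. If entry \<open>b\<close> of the beam is zero, the quotient
      is 0 by convention and the implication to be proved is vacuous.\<close>
    define f where "f y = - (\<Sum>b'\<in>UNIV - {b}. y (t, BS b' k) * W (\<chi> b. y (t, BD b)) $ b')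
      / W (\<chi> b. y (t, BD b)) $ b" for y :: "nat \<times> ('b, 'k) link \<Rightarrow> complex"
    have indep: "indep_var (PiM {?c} (\<lambda>_. borel))
        (\<lambda>\<omega>. restrict (\<lambda>i. (case i of (t, c) \<Rightarrow> h t c) \<omega>) {?c}) ?N ?Y"
      by (rule indep_var_restrict[OF channels_indep]) auto
    have [measurable]: "(\<lambda>y. W (\<chi> b. y (t, BD b)) $ b') \<in> borel_measurable ?N" for b'
      by (intro borel_measurable_vec_nth measurable_compose[OF _ W] borel_measurable_vec_lambda
          measurable_component_singleton) simp
    have "(\<lambda>y. y (t, BS b' k)) \<in> borel_measurable ?N" if "b' \<in> UNIV - {b}" for b'
      by (rule measurable_component_singleton) (use that in simp)
    then have "f \<in> borel_measurable ?N"
      unfolding f_def by (intro borel_measurable_divide borel_measurable_uminus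
          borel_measurable_sum borel_measurable_times) auto
    from indep_var_atomless_neq[OF indep _ _ this, of "\<lambda>z. z ?c"]
    have "AE \<omega> in M. h t (BS b k) \<omega> \<noteq> f (?Y \<omega>)"
      using channel_atomless[of "BS b k" t] by (simp add: measurable_component_singleton)
    then show ?thesis
    proof eventually_elim
      case (elim \<omega>)
      have "f (?Y \<omega>) = - (\<Sum>b'\<in>UNIV - {b}. h t (BS b' k) \<omega> * ?w \<omega> $ b') / ?w \<omega> $ b"
        by (simp add: f_def)
      with elim show ?case
        by (auto simp: tdot_def sum.remove[of UNIV b] field_simps add_eq_0_iff)
    qed
  qed
  then have "AE \<omega> in M. \<forall>b. ?w \<omega> $ b \<noteq> 0 \<longrightarrow> tdot (?v \<omega>) (?w \<omega>) \<noteq> 0"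
    unfolding AE_all_countable by blast
  then show ?thesis
    by eventually_elim (use W0 in \<open>auto simp: vec_eq_iff\<close>)
qed

text \<open>Almost surely every effective gain from the beacon is nonzero, so the harvested energy
  exceeds the full capacity of all sources once \<open>P\<close> is large. The selection does not
  depend on \<open>P\<close>, hence the two successor states then agree exactly.\<close>

lemma AE_next_state_limit:
  "AE \<omega> in M. \<forall>\<^sub>F P in at_top.
     next_state net P (\<lambda>c. h t c \<omega>) s = limit_next_state net (\<lambda>c. h t c \<omega>) s"
proof -
  let ?a = "efficiency net * slot_length net" and ?C = "real (max_level net) * level_energy net"
  have a: "0 < ?a" using efficiency_pos slot_length_pos by simp
  have ev: "\<forall>\<^sub>F P in at_top. ?C \<le> ?a * P * x\<^sup>2" if "x \<noteq> 0" for x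
    using eventually_ge_at_top[of "?C / (?a * x\<^sup>2)"]
  proof eventually_elim
    case (elim P)
    have "0 < ?a * x\<^sup>2" using a that by simp
    with elim show ?case by (simp add: divide_le_eq mult_ac)
  qed
  have "uniform_beam \<noteq> (0 :: complex ^ 'b)"
    by (simp add: uniform_beam_def vec_eq_iff)
  then have "AE \<omega> in M. \<forall>k. tdot (\<chi> b. h t (BS b k) \<omega>) uniform_beam \<noteq> 0"
    using AE_tdot_neq_0[of "\<lambda>_. uniform_beam" t] by (simp add: AE_all_countable)
  moreover have "null_beam net v \<noteq> 0" for v using null_beam_norm[of v] by auto
  then have "AE \<omega> in M. \<forall>k. tdot (\<chi> b. h t (BS b k) \<omega>) (null_beam net (\<chi> b. h t (BD b) \<omega>)) \<noteq> 0"
    using AE_tdot_neq_0[OF null_beam_measurable, of t] by (simp add: AE_all_countable)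
  ultimately show ?thesis
  proof eventually_elim
    case (elim \<omega>)
    let ?g = "\<lambda>c. h t c \<omega>"
    have "\<forall>\<^sub>F P in at_top. \<forall>k. ?C \<le> harvest_idle net P ?g k"
      unfolding harvest_idle_def by (intro eventually_all_finite ev) (use elim in simp)
    \<comment> \<open>The share from the beacon does not involve the transmitter, so one threshold
      on \<open>P\<close> serves every possible transmitter.\<close>
    moreover have "\<forall>\<^sub>F P in at_top. \<forall>k. ?C \<le> ?a * P *
        (cmod (tdot (\<chi> b. ?g (BS b k)) (null_beam net (\<chi> b. ?g (BD b)))))\<^sup>2"
      by (intro eventually_all_finite ev) (use elim in simp)
    ultimately show ?case
    proof eventually_elim
      case (elim P)
      have tx: "?C \<le> harvest_tx net P ?g i k" for i k
      proof -
        have "0 \<le> ?a * (tx_power net * (cmod (?g (SS i k)))\<^sup>2)"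
          using efficiency_pos slot_length_pos tx_power_pos by simp
        with elim(2)[rule_format, of k] show ?thesis
          by (simp add: harvest_tx_def distrib_left mult.assoc)
      qed
      show ?case
        using elim(1) tx
        by (cases "able_sources net s = {}")
           (auto simp: next_state_idle next_state_tx limit_next_state_def full_state_def
             state_after_tx_def recharge_full)
    qed
  qed
qed

lemma tendsto_prob_next_state:
  "((\<lambda>P. prob {\<omega> \<in> space M. next_state net P (\<lambda>c. h t c \<omega>) s = s'}) \<longlongrightarrow>
    prob {\<omega> \<in> space M. limit_next_state net (\<lambda>c. h t c \<omega>) s = s'}) at_top"
proof (rule tendsto_prob_eventually[OF next_state_event limit_next_state_event])
  show "AE \<omega> in M. \<forall>\<^sub>F P in at_top.
      \<omega> \<in> {\<omega> \<in> space M. next_state net P (\<lambda>c. h t c \<omega>) s = s'} \<longleftrightarrow>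
      \<omega> \<in> {\<omega> \<in> space M. limit_next_state net (\<lambda>c. h t c \<omega>) s = s'}"
    using AE_next_state_limit[of t s]
  proof eventually_elim
    case (elim \<omega>)
    then show ?case by eventually_elim simp
  qed
qed

end

section \<open>The energy outage probability\<close>

lemma transition_matrix_eq_kernel_matrix:
  "transition_matrix net M h \<sigma> P = kernel_matrix M \<sigma> (\<lambda>\<omega>. next_state net P (\<lambda>c. h 0 c \<omega>))"
  by (simp add: transition_matrix_def kernel_matrix_def)

text \<open>The unique existence claim gives meaning to the definite description in
  \<open>energy_outage_prob\<close>, and the invertibility claim gives meaning to
  \<open>matrix_inv\<close>.\<close>

theorem corollary1:
  fixes net :: "('b::finite, 'k::finite) network"
    and M :: "'a measure"
    and h :: "nat \<Rightarrow> ('b, 'k) link \<Rightarrow> 'a \<Rightarrow> complex"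
    and \<sigma> :: "'n::finite \<Rightarrow> 'k \<Rightarrow> nat"
  assumes "beacon_network net M h"
    and "bij_betw \<sigma> UNIV (energy_states net)"
  shows "(\<forall>P\<^sub>B>0. \<exists>!p. stationary_distribution (transition_matrix net M h \<sigma> P\<^sub>B) p) \<and>
    (\<exists>A :: real ^ 'n ^ 'n.
       (\<forall>n n'. ((\<lambda>P\<^sub>B. transition_matrix net M h \<sigma> P\<^sub>B $ n $ n') \<longlongrightarrow> A $ n $ n') at_top) \<and>
       invertible (transpose A - mat 1 + (\<chi> i j. 1)) \<and>
       ((\<lambda>P\<^sub>B. energy_outage_prob net M h \<sigma> P\<^sub>B) \<longlongrightarrow>
          (if CARD('k) = 1
           then \<Sum>n | \<sigma> n \<in> non_tx_states net.
                  (matrix_inv (transpose A - mat 1 + (\<chi> i j. 1)) *v (\<chi> i. 1)) $ n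
           else 0)) at_top)"
proof -
  interpret beacon_network net M h by fact
  note \<sigma> = assms(2)
  have \<sigma>_in: "\<sigma> n \<in> energy_states net" for n using \<sigma> by (auto simp: bij_betw_def)
  let ?T = "transition_matrix net M h \<sigma>"
  define A where "A = kernel_matrix M \<sigma> (\<lambda>\<omega>. limit_next_state net (\<lambda>c. h 0 c \<omega>))"
  have T: "stochastic (?T P)" "rooted (?T P)" if "0 < P" for P
    unfolding transition_matrix_eq_kernel_matrix
    by (rule stochastic_kernel_matrix[OF \<sigma> next_state_in next_state_event])
       (auto intro!: rooted_if_limit_steps_pos[OF \<sigma> tx_levels_pos tx_levels_le]
         next_step_prob_pos that simp: kernel_matrix_def)
  have A: "stochastic A" "rooted A"
    unfolding A_def
    by (rule stochastic_kernel_matrix[OF \<sigma> limit_next_state_in limit_next_state_event])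
       (auto intro!: rooted_if_limit_steps_pos[OF \<sigma> tx_levels_pos tx_levels_le]
         limit_step_prob_pos simp: kernel_matrix_def)
  have lim: "((\<lambda>P. ?T P $ n $ n') \<longlongrightarrow> A $ n $ n') at_top" for n n'
    unfolding transition_matrix_eq_kernel_matrix A_def kernel_matrix_def
    by (simp add: tendsto_prob_next_state)
  have "\<forall>\<^sub>F P in at_top. stochastic (?T P) \<and> rooted (?T P)"
    using eventually_gt_at_top[of 0] by eventually_elim (simp add: T)
  then have "((\<lambda>P. stationary_vector (?T P)) \<longlongrightarrow> stationary_vector A) at_top"
    by (rule tendsto_stationary_vector[OF A _ lim])
  then have "((\<lambda>P. \<Sum>n | \<sigma> n \<in> non_tx_states net. stationary_vector (?T P) $ n) \<longlongrightarrow>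
      (\<Sum>n | \<sigma> n \<in> non_tx_states net. stationary_vector A $ n)) at_top"
    by (intro tendsto_sum tendsto_vec_nth)
  \<comment> \<open>At positive power the definite description is the stationary vector, and the
    outage states are exactly the non-transmission states.\<close>
  moreover have "\<forall>\<^sub>F P in at_top. (\<Sum>n | \<sigma> n \<in> non_tx_states net. stationary_vector (?T P) $ n) =
      energy_outage_prob net M h \<sigma> P"
    using eventually_gt_at_top[of 0]
  proof eventually_elim
    case (elim P)
    have "(THE p. stationary_distribution (?T P) p) = stationary_vector (?T P)"
      by (simp add: stationary_distribution_iff[OF T[OF elim]])
    moreover have "\<sigma> n \<in> non_tx_states net \<longleftrightarrow> (\<forall>k. \<sigma> n k < tx_levels net)" for n
      using \<sigma>_in by (auto simp: non_tx_states_def able_sources_def not_le)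
    ultimately show ?case by (simp add: energy_outage_prob_def)
  qed
  ultimately have outage: "(energy_outage_prob net M h \<sigma> \<longlongrightarrow>
      (\<Sum>n | \<sigma> n \<in> non_tx_states net. stationary_vector A $ n)) at_top"
    by (rule Lim_transform_eventually)
  \<comment> \<open>No limit step ends in a non-transmission state, so column \<open>n\<close> of
    \<open>A\<close> is zero, and stationarity carries this over to entry \<open>n\<close>.\<close>
  have "stationary_vector A $ n = 0" if "CARD('k) \<noteq> 1" "\<sigma> n \<in> non_tx_states net" for n
  proof -
    have "limit_next_state net g s \<noteq> \<sigma> n" for g s
      using limit_next_state_able[OF tx_levels_le \<open>CARD('k) \<noteq> 1\<close>] that(2)
      by (metis (mono_tags, lifting) mem_Collect_eq non_tx_states_def)
    then have "A $ i $ n = 0" for i by (simp add: A_def kernel_matrix_def)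
    moreover have "stationary_vector A v* A = stationary_vector A"
      using stationary_distribution_stationary_vector[OF A] by (simp add: stationary_distribution_def)
    then have "stationary_vector A $ n = (\<Sum>i\<in>UNIV. stationary_vector A $ i * A $ i $ n)"
      by (metis vector_matrix_mult_nth)
    ultimately show ?thesis by simp
  qed
  then have eq: "(\<Sum>n | \<sigma> n \<in> non_tx_states net. stationary_vector A $ n) =
      (if CARD('k) = 1 then \<Sum>n | \<sigma> n \<in> non_tx_states net.
         (matrix_inv (transpose A - mat 1 + (\<chi> i j. 1)) *v (\<chi> i. 1)) $ n else 0)"
    by (auto simp: stationary_vector_def stationary_matrix_def intro!: sum.neutral)
  have "invertible (transpose A - mat 1 + (\<chi> i j. 1))"
    using invertible_stationary_matrix[OF A] by (simp add: stationary_matrix_def)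
  moreover have "\<exists>!p. stationary_distribution (?T P) p" if "0 < P" for P
    by (simp add: stationary_distribution_iff[OF T[OF that]])
  ultimately show ?thesis using lim outage unfolding eq by blast
qed

end
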